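(* Let $G$ be an instance of the scheduling game $P||\sum_jC_j$. Then the robust price of anarchy of any friendship extension $G^\alpha$ of $G$ is at most $2$.
   Context: Scheduling game $P||\sum_jC_j$: there are jobs (players) $1,\dots,n$ and $m$ identical machines; job $j$ has processing time $p_j\in\mathbb R_+$ (on every machine). Each job's strategy set is the set of machines; in a schedule (profile) $x$, $x_j$ is the machine of job $j$. Jobs are indexed such that $p_j>p_{j'}$ implies $j>j'$, and on each machine the assigned jobs are processed in increasing order of index (shortest processing time first). The cost of job $j$ is its completion time $C_j(x)=\sum_{k\le j:\,x_k=x_j}p_k$, and the social cost is $C(x)=\sum_jC_j(x)$. A schedule is optimal if it minimizes $C$. $(t,x_{-j})$ denotes $x$ with job $j$ moved to machine $t$. Friendship extension: for $\alpha\in[0,1]^{n\times n}$ with $\alpha_{jj}=1$ for all $j$, $G^\alpha$ is the game with the same players and strategies and costs $C_j^\alpha=\sum_k\alpha_{jk}C_k$; its social cost is again $C$. Smoothness: $G^\alpha$ is $(\lambda,\mu)$-smooth if there is a (possibly randomized) schedule $\bar x$ such that for all schedules $x$ and all optimal schedules $x^*$, $$\sum_j\Big(C_j(\bar x_j,x_{-j})+\sum_{k\ne j}\alpha_{jk}\big(C_k(\bar x_j,x_{-j})-C_k(x)\big)\Big)\le\lambda C(x^* )+\mu C(x)$$ (left-hand side in expectation over $\bar x$ if it is randomized). The robust price of anarchy of $G^\alpha$ is $\inf\{\frac{\lambda}{1-\mu} : G^\alpha\text{ is }(\lambda,\mu)\text{-smooth},\ \mu<1\}$. *)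

theory Defs
  imports "HOL-Probability.Probability"
begin

section \<open>Cost minimisation games, friendship extensions and smoothness\<close>

text \<open>
  A game is given by a set of players \<open>N\<close>, strategy sets \<open>S i\<close> and costs \<open>C i x\<close>. Profiles are
  extensional functions on \<open>N\<close>, so that \<open>x(j := t)\<close> is the profile usually written
  \<open>(t, x\<^sub>-\<^sub>j)\<close>.
\<close>

definition profiles :: "'i set \<Rightarrow> ('i \<Rightarrow> 's set) \<Rightarrow> ('i \<Rightarrow> 's) set" where
  "profiles N S = Pi\<^sub>E N S"

definition social_cost :: "'i set \<Rightarrow> ('i \<Rightarrow> ('i \<Rightarrow> 's) \<Rightarrow> real) \<Rightarrow> ('i \<Rightarrow> 's) \<Rightarrow> real" where
  "social_cost N C x = (\<Sum>j\<in>N. C j x)"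

definition optimal ::
    "'i set \<Rightarrow> ('i \<Rightarrow> 's set) \<Rightarrow> ('i \<Rightarrow> ('i \<Rightarrow> 's) \<Rightarrow> real) \<Rightarrow> ('i \<Rightarrow> 's) \<Rightarrow> bool" where
  "optimal N S C x \<longleftrightarrow>
     x \<in> profiles N S \<and> (\<forall>y\<in>profiles N S. social_cost N C x \<le> social_cost N C y)"

definition friendship_matrix :: "'i set \<Rightarrow> ('i \<Rightarrow> 'i \<Rightarrow> real) \<Rightarrow> bool" where
  "friendship_matrix N \<alpha> \<longleftrightarrow>
     (\<forall>j\<in>N. \<forall>k\<in>N. 0 \<le> \<alpha> j k \<and> \<alpha> j k \<le> 1) \<and> (\<forall>j\<in>N. \<alpha> j j = 1)"

definition friendship_cost ::
    "'i set \<Rightarrow> ('i \<Rightarrow> ('i \<Rightarrow> 's) \<Rightarrow> real) \<Rightarrow> ('i \<Rightarrow> 'i \<Rightarrow> real) \<Rightarrow> 'i \<Rightarrow> ('i \<Rightarrow> 's) \<Rightarrow> real" where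
  "friendship_cost N C \<alpha> j x = (\<Sum>k\<in>N. \<alpha> j k * C k x)"

text \<open>
  The friendship extension of a game is determined by the base game and \<open>\<alpha>\<close>; its social cost,
  and hence its optimal profiles, are those of the base game. The randomised profile \<open>D\<close> may be
  correlated across players, and deterministic profiles are the point distributions
  \<open>return_pmf\<close>. The parameters \<open>l\<close> and \<open>u\<close> stand for \<open>\<lambda>\<close> and \<open>\<mu>\<close>.
\<close>

definition friendship_smooth ::
    "'i set \<Rightarrow> ('i \<Rightarrow> 's set) \<Rightarrow> ('i \<Rightarrow> ('i \<Rightarrow> 's) \<Rightarrow> real) \<Rightarrow> ('i \<Rightarrow> 'i \<Rightarrow> real) \<Rightarrow>
      real \<Rightarrow> real \<Rightarrow> bool" where
  "friendship_smooth N S C \<alpha> l u \<longleftrightarrow>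
     (\<exists>D :: ('i \<Rightarrow> 's) pmf. set_pmf D \<subseteq> profiles N S \<and>
       (\<forall>x\<in>profiles N S. \<forall>z. optimal N S C z \<longrightarrow>
          measure_pmf.expectation D (\<lambda>y. \<Sum>j\<in>N.
              C j (x(j := y j))
              + (\<Sum>k\<in>N - {j}. \<alpha> j k * (C k (x(j := y j)) - C k x)))
          \<le> l * social_cost N C z + u * social_cost N C x))"

text \<open>
  The summand in \<open>friendship_smooth\<close> is the change of the extended cost of \<open>j\<close> under the
  deviation, plus the original cost of \<open>j\<close>.
\<close>

lemma friendship_deviation_eq:
  assumes "finite N" "j \<in> N" "friendship_matrix N \<alpha>"
  shows "C j x' + (\<Sum>k\<in>N - {j}. \<alpha> j k * (C k x' - C k x))
       = friendship_cost N C \<alpha> j x' - friendship_cost N C \<alpha> j x + C j x"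
proof -
  have "friendship_cost N C \<alpha> j y = C j y + (\<Sum>k\<in>N - {j}. \<alpha> j k * C k y)" for y
    using assms by (simp add: friendship_cost_def friendship_matrix_def sum.remove[of N j])
  then show ?thesis
    by (simp add: right_diff_distrib sum_subtractf)
qed

text \<open>
  The infimum is taken in the extended reals, so that it is meaningful also for an empty or
  unbounded set of ratios.
\<close>

definition robust_poa ::
    "'i set \<Rightarrow> ('i \<Rightarrow> 's set) \<Rightarrow> ('i \<Rightarrow> ('i \<Rightarrow> 's) \<Rightarrow> real) \<Rightarrow> ('i \<Rightarrow> 'i \<Rightarrow> real) \<Rightarrow> ereal" where
  "robust_poa N S C \<alpha> =
     Inf {ereal (l / (1 - u)) | l u. friendship_smooth N S C \<alpha> l u \<and> u < 1}"


section \<open>The scheduling game on identical machines\<close>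

text \<open>
  Jobs are \<open>1, \<dots>, n\<close> and machines are \<open>1, \<dots>, m\<close>. Processing times may be zero. As the indexing
  is compatible with the processing times, shortest processing time first is increasing index
  order, with ties broken by index; this is why only jobs \<open>k \<le> j\<close> enter \<open>completion_time p j\<close>.
\<close>

definition scheduling_instance :: "nat \<Rightarrow> nat \<Rightarrow> (nat \<Rightarrow> real) \<Rightarrow> bool" where
  "scheduling_instance n m p \<longleftrightarrow>
     m \<ge> 1 \<and> (\<forall>j\<in>{1..n}. p j \<ge> 0) \<and>
     (\<forall>j\<in>{1..n}. \<forall>j'\<in>{1..n}. p j > p j' \<longrightarrow> j > j')"

definition completion_time :: "(nat \<Rightarrow> real) \<Rightarrow> nat \<Rightarrow> (nat \<Rightarrow> nat) \<Rightarrow> real" where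
  "completion_time p j x = (\<Sum>k | k \<in> {1..j} \<and> x k = x j. p k)"

end

theory Submission imports Defs
begin

text \<open>
  Let all jobs deviate to one machine drawn uniformly at random. Every job then sees a uniform
  machine, so its expected completion time is \<open>p\<^sub>j + (\<Sum>i<j. p\<^sub>i) / m\<close>, and a later job \<open>k\<close> is
  delayed in expectation by at most \<open>p\<^sub>j / m\<close>. Hence the smoothness sum is at most
  \<open>(\<Sum>j. (m + 2 (n - j)) p\<^sub>j) / m\<close>. A variant of the bound of Eastman, Even and Isaacs shows that this
  is at most twice the social cost of any schedule, so that the game is \<open>(2, 0)\<close>-smooth.
\<close>

section \<open>Lower bound on the social cost of a schedule\<close>

text \<open>Abel summation: as \<open>V (Suc n) = 0\<close>, the sum equals \<open>f 1 * V 1\<close>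
  plus the terms \<open>(f k - f (k - 1)) * V k\<close> for \<open>k\<close> from 2 to
  \<open>n\<close>, all nonnegative.\<close>

lemma summation_by_parts_nonneg:
  fixes f V :: "nat \<Rightarrow> real"
  assumes "\<And>k. k \<in> {1..n} \<Longrightarrow> 0 \<le> f k"
    and "\<And>k. 1 \<le> k \<Longrightarrow> k < n \<Longrightarrow> f k \<le> f (Suc k)"
    and "\<And>k. 1 \<le> k \<Longrightarrow> 0 \<le> V k" and "V (Suc n) = 0"
  shows "0 \<le> (\<Sum>k=1..n. f k * (V k - V (Suc k)))"
proof (cases "n = 0")
  case False
  \<comment> \<open>The partial sums carry a boundary term, which vanishes at \<open>N = n\<close>.
    The induction starts at 1, where the bounds on \<open>f\<close> and \<open>V\<close>
    begin.\<close>
  have "- f N * V (Suc N) \<le> (\<Sum>k=1..N. f k * (V k - V (Suc k)))" if "N \<ge> 1" "N \<le> n" for N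
    using that
  proof (induction N rule: nat_induct_at_least)
    case base
    then show ?case
      using assms(1)[of 1] assms(3)[of 1] by (simp add: algebra_simps)
  next
    case (Suc N)
    have "f N * V (Suc N) \<le> f (Suc N) * V (Suc N)"
      using Suc.prems Suc.hyps assms(2)[of N] assms(3) by (intro mult_right_mono) auto
    then show ?case
      using Suc by (simp add: algebra_simps)
  qed
  from this[of n] show ?thesis
    using False assms(4) by simp
qed simp

lemma completion_time_eq_sum:
  "completion_time p j x = (\<Sum>k=1..j. if x k = x j then p k else 0)"
proof -
  have "{k. k \<in> {1..j} \<and> x k = x j} = {1..j} \<inter> {k. x k = x j}"
    by auto
  then show ?thesis
    by (simp add: completion_time_def sum.inter_restrict)
qed

lemma sum_swap_upto:
  fixes f :: "nat \<Rightarrow> nat \<Rightarrow> 'a::comm_monoid_add"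
  shows "(\<Sum>j=1..n. \<Sum>k=1..j. f j k) = (\<Sum>k=1..n. \<Sum>j=k..n. f j k)"
proof -
  have "(\<Sum>j=1..n. \<Sum>k=1..j. f j k) = (\<Sum>j=1..n. \<Sum>k | k \<in> {1..n} \<and> k \<le> j. f j k)"
    by (intro sum.cong) auto
  also have "\<dots> = (\<Sum>k=1..n. \<Sum>j | j \<in> {1..n} \<and> k \<le> j. f j k)"
    by (rule sum.swap_restrict) simp_all
  also have "\<dots> = (\<Sum>k=1..n. \<Sum>j=k..n. f j k)"
    by (intro sum.cong) auto
  finally show ?thesis .
qed

text \<open>For \<open>k \<le> n\<close> and \<open>t = z k\<close> this counts the jobs whose
  completion time contains \<open>p k\<close>, including \<open>k\<close> itself. It is real-valued
  so that loads can be squared and subtracted.\<close>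

definition load_from :: "nat \<Rightarrow> (nat \<Rightarrow> nat) \<Rightarrow> nat \<Rightarrow> nat \<Rightarrow> real" where
  "load_from n z k t = (\<Sum>j=k..n. if z j = t then 1 else 0)"

text \<open>Double counting: \<open>p k\<close> is paid once by each job from \<open>k\<close>
  onwards on the machine of \<open>k\<close>.\<close>

lemma social_cost_completion_time:
  "social_cost {1..n} (completion_time p) z = (\<Sum>k=1..n. p k * load_from n z k (z k))"
proof -
  have "social_cost {1..n} (completion_time p) z
      = (\<Sum>j=1..n. \<Sum>k=1..j. if z k = z j then p k else 0)"
    by (simp add: social_cost_def completion_time_eq_sum)
  also have "\<dots> = (\<Sum>k=1..n. \<Sum>j=k..n. if z k = z j then p k else 0)"
    by (rule sum_swap_upto)
  finally show ?thesis
    by (simp add: load_from_def sum_distrib_left if_distrib eq_commute[of "z _" "z _"]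
        cong: if_cong)
qed

lemma load_from_Suc:
  assumes "k \<le> n"
  shows "load_from n z k t = (if z k = t then 1 else 0) + load_from n z (Suc k) t"
  using assms by (simp add: load_from_def sum.atLeast_Suc_atMost)

lemma sum_load_from:
  assumes "z \<in> profiles {1..n} (\<lambda>_. {1..m})" "1 \<le> k"
  shows "(\<Sum>t=1..m. load_from n z k t) = real (Suc n - k)"
proof -
  have "(\<Sum>t=1..m. load_from n z k t) = (\<Sum>j=k..n. \<Sum>t=1..m. if z j = t then 1 else 0)"
    unfolding load_from_def by (rule sum.swap)
  also have "\<dots> = (\<Sum>j=k..n. 1)"
  proof (rule sum.cong)
    fix j assume "j \<in> {k..n}"
    then have "z j \<in> {1..m}"
      using assms by (auto simp: profiles_def PiE_def Pi_def)
    then show "(\<Sum>t=1..m. if z j = t then 1 else 0) = (1::real)"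
      by simp
  qed simp
  finally show ?thesis
    by simp
qed

text \<open>Discarding job \<open>k\<close> lowers only the load \<open>L\<close> of its own
  machine, by one, and \<open>L^2 - (L - 1)^2 = 2 * L - 1\<close>.\<close>

lemma sum_load_from_squares_Suc:
  assumes "k \<le> n" "z k \<in> {1..m}"
  shows "(\<Sum>t=1..m. (load_from n z k t)\<^sup>2)
    = (\<Sum>t=1..m. (load_from n z (Suc k) t)\<^sup>2) + 2 * load_from n z k (z k) - 1"
proof -
  have "(load_from n z k t)\<^sup>2 = (load_from n z (Suc k) t)\<^sup>2
      + (if z k = t then 2 * load_from n z k (z k) - 1 else 0)" for t
    by (auto simp: load_from_Suc[OF assms(1)] power2_eq_square algebra_simps)
  then show ?thesis
    using assms(2) by (simp add: sum.distrib)
qed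

text \<open>The loads of the jobs \<open>k..n\<close> satisfy Cauchy-Schwarz for every
  \<open>k\<close>. Weighting the differences of consecutive slacks by the nondecreasing
  \<open>p k\<close> turns these inequalities into the bound.\<close>

lemma social_cost_lower_bound:
  assumes inst: "scheduling_instance n m p"
    and z: "z \<in> profiles {1..n} (\<lambda>_. {1..m})"
  shows "(\<Sum>k=1..n. (real m + 2 * (real n - real k)) * p k)
    \<le> 2 * real m * social_cost {1..n} (completion_time p) z"
proof -
  \<comment> \<open>\<open>V k\<close> is the Cauchy-Schwarz slack of the \<open>m\<close> loads,
    whose sum is \<open>Suc n - k\<close>. At \<open>k = Suc n\<close> there are no jobs left and
    both terms are 0.\<close>
  define V where "V k = real m * (\<Sum>t=1..m. (load_from n z k t)\<^sup>2) - (real (Suc n - k))\<^sup>2" for k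
  have V_nonneg: "0 \<le> V k" if "1 \<le> k" for k
  proof -
    have "(real (Suc n - k))\<^sup>2 = (\<Sum>t=1..m. load_from n z k t)\<^sup>2"
      using sum_load_from[OF z that] by simp
    also have "\<dots> \<le> (\<Sum>t=1..m. (load_from n z k t)\<^sup>2) * real (card {1..m})"
      by (rule sum_squared_le_sum_of_squares)
    finally show ?thesis
      by (simp add: V_def mult.commute)
  qed
  have V_Suc: "V k - V (Suc k)
      = 2 * real m * load_from n z k (z k) - real m - 2 * (real n - real k) - 1"
    if "k \<in> {1..n}" for k
  proof -
    have "z k \<in> {1..m}"
      using that z by (auto simp: profiles_def PiE_def Pi_def)
    moreover have "real (Suc n - k) = real n - real k + 1" "real (n - k) = real n - real k"
      using that by (auto simp: of_nat_diff)
    moreover have "(\<Sum>t=1..m. (load_from n z k t)\<^sup>2)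
        - (\<Sum>t=1..m. (load_from n z (Suc k) t)\<^sup>2) = 2 * load_from n z k (z k) - 1"
      using that sum_load_from_squares_Suc[of k n z m] \<open>z k \<in> {1..m}\<close> by simp
    moreover have "V k - V (Suc k) = real m * ((\<Sum>t=1..m. (load_from n z k t)\<^sup>2)
        - (\<Sum>t=1..m. (load_from n z (Suc k) t)\<^sup>2))
        - ((real (Suc n - k))\<^sup>2 - (real (n - k))\<^sup>2)"
      using that by (simp add: V_def right_diff_distrib)
    ultimately show ?thesis
      by (simp only:) (simp add: power2_eq_square algebra_simps)
  qed
  have p_nonneg: "0 \<le> p k" if "k \<in> {1..n}" for k
    using inst that by (auto simp: scheduling_instance_def)
  have "0 \<le> (\<Sum>k=1..n. p k * (V k - V (Suc k)))"
  proof (rule summation_by_parts_nonneg)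
    show "p k \<le> p (Suc k)" if "1 \<le> k" "k < n" for k
    proof (rule ccontr)
      assume "\<not> p k \<le> p (Suc k)"
      then have "Suc k < k"
        using inst that unfolding scheduling_instance_def by auto
      then show False
        by simp
    qed
    show "V (Suc n) = 0"
      by (simp add: V_def load_from_def)
  qed (use p_nonneg V_nonneg in auto)
  \<comment> \<open>The final \<open>- 1\<close> in \<open>V_Suc\<close> is dropped, which gives
    away \<open>p k \<ge> 0\<close> in each term.\<close>
  also have "\<dots> \<le> (\<Sum>k=1..n. 2 * real m * (p k * load_from n z k (z k))
      - (real m + 2 * (real n - real k)) * p k)"
  proof (rule sum_mono)
    fix k assume k: "k \<in> {1..n}"
    show "p k * (V k - V (Suc k)) \<le> 2 * real m * (p k * load_from n z k (z k))
      - (real m + 2 * (real n - real k)) * p k"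
      unfolding V_Suc[OF k] using p_nonneg[OF k] by (simp add: algebra_simps)
  qed
  finally show ?thesis
    unfolding social_cost_completion_time sum_subtractf sum_distrib_left[symmetric] by simp
qed

section \<open>Completion times under a unilateral deviation\<close>

lemma completion_time_deviate_self:
  assumes "1 \<le> j"
  shows "completion_time p j (x(j := t)) = p j + (\<Sum>i=1..<j. if x i = t then p i else 0)"
proof -
  have "{1..j} = insert j {1..<j}"
    using assms by auto
  then show ?thesis
    by (auto simp: completion_time_eq_sum intro!: sum.cong)
qed

text \<open>A job \<open>k < j\<close> is processed before \<open>j\<close> and never notices its
  move. A later job gains the summand \<open>p j\<close> if it sits on the new machine and loses it
  if it sits on the old one; the two cancel when the machines agree.\<close>

lemma completion_time_deviate_other:
  assumes "1 \<le> j" "k \<noteq> j"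
  shows "completion_time p k (x(j := t)) - completion_time p k x
    = (if j < k then p j * ((if x k = t then 1 else 0) - (if x k = x j then 1 else 0)) else 0)"
proof (cases "j < k")
  case True
  then have j: "j \<in> {1..k}"
    using assms by simp
  have split: "completion_time p k y = (if y j = y k then p j else 0)
      + (\<Sum>i\<in>{1..k} - {j}. if y i = y k then p i else 0)" for y
    unfolding completion_time_eq_sum by (rule sum.remove) (use j in auto)
  have "(\<Sum>i\<in>{1..k} - {j}. if (x(j := t)) i = (x(j := t)) k then p i else 0)
      = (\<Sum>i\<in>{1..k} - {j}. if x i = x k then p i else 0)"
    using assms by (intro sum.cong) auto
  then show ?thesis
    unfolding split using assms True by auto
next
  case False
  then show ?thesis
    using assms by (auto simp: completion_time_eq_sum intro!: sum.cong)
qed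

text \<open>Summing over all \<open>t\<close> gives \<open>m\<close> times the expectation under a
  uniform machine, without division. The factor 2 arises because \<open>p j\<close> is counted for
  the \<open>n - j\<close> later jobs twice: in their own deviation costs, and as the delay that
  \<open>j\<close> inflicts on them.\<close>

lemma deviation_sum_le:
  assumes inst: "scheduling_instance n m p"
    and fr: "friendship_matrix {1..n} \<alpha>"
    and x: "x \<in> profiles {1..n} (\<lambda>_. {1..m})"
  shows "(\<Sum>t=1..m. \<Sum>j=1..n. completion_time p j (x(j := t))
      + (\<Sum>k\<in>{1..n} - {j}. \<alpha> j k * (completion_time p k (x(j := t)) - completion_time p k x)))
    \<le> (\<Sum>j=1..n. (real m + 2 * (real n - real j)) * p j)"
proof -
  have p_nonneg: "0 \<le> p j" if "j \<in> {1..n}" for j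
    using inst that by (auto simp: scheduling_instance_def)
  have m: "1 \<le> m"
    using inst by (simp add: scheduling_instance_def)
  have xm: "x j \<in> {1..m}" if "j \<in> {1..n}" for j
    using x that by (auto simp: profiles_def PiE_def Pi_def)
  have one: "(\<Sum>t=1..m. if x j = t then c else 0) = c" if "j \<in> {1..n}" for j and c :: real
    using xm[OF that] by simp
  have self: "(\<Sum>t=1..m. completion_time p j (x(j := t))) = real m * p j + (\<Sum>i=1..<j. p i)"
    if "j \<in> {1..n}" for j
  proof -
    have "(\<Sum>t=1..m. \<Sum>i=1..<j. if x i = t then p i else 0) = (\<Sum>i=1..<j. p i)"
      by (subst sum.swap, intro sum.cong refl, subst one) (use that in auto)
    then show ?thesis
      using that by (simp add: completion_time_deviate_self sum.distrib)
  qed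
  have other: "(\<Sum>t=1..m. \<alpha> j k * (completion_time p k (x(j := t)) - completion_time p k x))
      \<le> (if j < k then p j else 0)" if "j \<in> {1..n}" "k \<in> {1..n} - {j}" for j k
  proof (cases "j < k")
    case True
    have a: "0 \<le> \<alpha> j k" "\<alpha> j k \<le> 1"
      using fr that by (auto simp: friendship_matrix_def)
    have "(\<Sum>t=1..m. \<alpha> j k * (completion_time p k (x(j := t)) - completion_time p k x))
        = \<alpha> j k * (p j * ((\<Sum>t=1..m. if x k = t then 1 else 0)
          - real m * (if x k = x j then 1 else 0)))"
      using that True
      by (simp add: completion_time_deviate_other sum_distrib_left[symmetric] sum_subtractf)
    also have "\<dots> = \<alpha> j k * (p j * (1 - real m * (if x k = x j then 1 else 0)))"
      using that by (subst one) auto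
    \<comment> \<open>The relief felt by jobs on the old machine of \<open>j\<close> is discarded;
      what remains is the delay on the single machine \<open>t = x k\<close>.\<close>
    also have "\<dots> \<le> \<alpha> j k * (p j * 1)"
      using a p_nonneg[OF that(1)] by (intro mult_left_mono) auto
    also have "\<dots> \<le> p j"
      using a p_nonneg[OF that(1)] by (simp add: mult_left_le_one_le)
    finally show ?thesis
      using True by simp
  next
    case False
    then show ?thesis
      using that by (simp add: completion_time_deviate_other)
  qed
  have others: "(\<Sum>t=1..m. \<Sum>k\<in>{1..n} - {j}.
        \<alpha> j k * (completion_time p k (x(j := t)) - completion_time p k x))
      \<le> (real n - real j) * p j" if "j \<in> {1..n}" for j
  proof -
    have "(\<Sum>t=1..m. \<Sum>k\<in>{1..n} - {j}.
        \<alpha> j k * (completion_time p k (x(j := t)) - completion_time p k x))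
      \<le> (\<Sum>k\<in>{1..n} - {j}. if j < k then p j else 0)"
      by (subst sum.swap) (intro sum_mono other that)
    also have "\<dots> = (\<Sum>k\<in>{j<..n}. p j)"
      using that by (intro sum.mono_neutral_cong_right) auto
    finally show ?thesis
      using that by (simp add: of_nat_diff)
  qed
  have "(\<Sum>j=1..n. \<Sum>i=1..<j. p i) = (\<Sum>j=1..n. (\<Sum>i=1..j. p i) - p j)"
  proof (rule sum.cong)
    fix j assume "j \<in> {1..n}"
    then have "{1..j} = insert j {1..<j}"
      by auto
    then show "(\<Sum>i=1..<j. p i) = (\<Sum>i=1..j. p i) - p j"
      by simp
  qed simp
  \<comment> \<open>\<open>p k\<close> occurs in \<open>n - k + 1\<close> of the full prefix sums;
    removing each job's own time leaves \<open>n - k\<close>.\<close>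
  also have "\<dots> = (\<Sum>k=1..n. \<Sum>j=k..n. p k) - (\<Sum>j=1..n. p j)"
    by (simp only: sum_subtractf sum_swap_upto)
  also have "\<dots> = (\<Sum>k=1..n. (real n - real k) * p k)"
    unfolding sum_subtractf[symmetric]
    by (intro sum.cong) (auto simp: of_nat_diff algebra_simps)
  finally have earlier: "(\<Sum>j=1..n. \<Sum>i=1..<j. p i) = (\<Sum>k=1..n. (real n - real k) * p k)" .
  have "(\<Sum>t=1..m. \<Sum>j=1..n. completion_time p j (x(j := t))
      + (\<Sum>k\<in>{1..n} - {j}. \<alpha> j k * (completion_time p k (x(j := t)) - completion_time p k x)))
    = (\<Sum>j=1..n. (\<Sum>t=1..m. completion_time p j (x(j := t)))
      + (\<Sum>t=1..m. \<Sum>k\<in>{1..n} - {j}.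
          \<alpha> j k * (completion_time p k (x(j := t)) - completion_time p k x)))"
    by (subst sum.swap) (simp add: sum.distrib)
  also have "\<dots> \<le> (\<Sum>j=1..n. (real m * p j + (\<Sum>i=1..<j. p i)) + (real n - real j) * p j)"
    by (intro sum_mono add_mono others) (simp_all only: self order.refl)
  also have "\<dots> = (\<Sum>j=1..n. (real m + 2 * (real n - real j)) * p j)"
    unfolding sum.distrib earlier
    by (simp add: algebra_simps sum.distrib sum_subtractf sum_distrib_left)
  finally show ?thesis .
qed

section \<open>Smoothness and the price of anarchy\<close>

lemma friendship_smooth_scheduling:
  assumes inst: "scheduling_instance n m p"
    and fr: "friendship_matrix {1..n} \<alpha>"
  shows "friendship_smooth {1..n} (\<lambda>_. {1..m}) (completion_time p) \<alpha> 2 0"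
proof -
  have m: "1 \<le> m"
    using inst by (simp add: scheduling_instance_def)
  \<comment> \<open>A single draw shared by all jobs suffices: the summand of \<open>j\<close>
    depends on the random profile only through its \<open>j\<close>-th coordinate, so by linearity
    only the uniform marginals matter.\<close>
  define D :: "(nat \<Rightarrow> nat) pmf"
    where "D = map_pmf (\<lambda>t. \<lambda>j\<in>{1..n}. t) (pmf_of_set {1..m})"
  have "set_pmf D \<subseteq> profiles {1..n} (\<lambda>_. {1..m})"
    using m by (auto simp: D_def profiles_def)
  moreover have "measure_pmf.expectation D (\<lambda>y. \<Sum>j=1..n.
        completion_time p j (x(j := y j))
        + (\<Sum>k\<in>{1..n} - {j}. \<alpha> j k *
            (completion_time p k (x(j := y j)) - completion_time p k x)))
      \<le> 2 * social_cost {1..n} (completion_time p) z"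
    (is "measure_pmf.expectation D ?F \<le> _")
    if x: "x \<in> profiles {1..n} (\<lambda>_. {1..m})" and z: "z \<in> profiles {1..n} (\<lambda>_. {1..m})" for x z
  proof -
    have "real m * measure_pmf.expectation D ?F = (\<Sum>t=1..m. ?F (\<lambda>j\<in>{1..n}. t))"
      using m by (simp add: D_def integral_map_pmf integral_pmf_of_set)
    also have "\<dots> = (\<Sum>t=1..m. \<Sum>j=1..n. completion_time p j (x(j := t))
      + (\<Sum>k\<in>{1..n} - {j}. \<alpha> j k * (completion_time p k (x(j := t)) - completion_time p k x)))"
      by (intro sum.cong refl) simp
    also have "\<dots> \<le> (\<Sum>j=1..n. (real m + 2 * (real n - real j)) * p j)"
      by (rule deviation_sum_le[OF inst fr x])
    also have "\<dots> \<le> real m * (2 * social_cost {1..n} (completion_time p) z)"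
      using social_cost_lower_bound[OF inst z] by (simp add: mult_ac)
    finally show ?thesis
      using m by (simp only: mult_le_cancel_left_pos of_nat_0_less_iff)
  qed
  ultimately show ?thesis
    unfolding friendship_smooth_def optimal_def by (intro exI[of _ D]) auto
qed

theorem theorem7:
  fixes n m :: nat and p :: "nat \<Rightarrow> real" and \<alpha> :: "nat \<Rightarrow> nat \<Rightarrow> real"
  assumes "scheduling_instance n m p"
    and "friendship_matrix {1..n} \<alpha>"
  shows "robust_poa {1..n} (\<lambda>_. {1..m}) (completion_time p) \<alpha> \<le> 2"
proof -
  have "robust_poa {1..n} (\<lambda>_. {1..m}) (completion_time p) \<alpha> \<le> ereal (2 / (1 - 0))"
    unfolding robust_poa_def
    \<comment> \<open>The ratio was left as \<open>2 / (1 - 0)\<close> so that \<open>refl\<close>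
      instantiates \<open>l\<close> to 2 and \<open>u\<close> to 0 by unification.\<close>
    by (rule Inf_lower, intro CollectI exI conjI, rule refl)
      (use friendship_smooth_scheduling[OF assms] in auto)
  then show ?thesis
    by simp
qed

end
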